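(* Let $\mathcal G$ be a family of subsets of $\omega$ that is maximal with respect to the condition that for every $A,B\in\mathcal G$ there exist $\varepsilon_1,\varepsilon_2\in\{0,1\}$ such that $A^{\varepsilon_1}\cap B^{\varepsilon_2}$ is finite. Let $\mathfrak F$ be the subalgebra of $P(\omega)$ generated by $\mathcal G$. Then the Boolean algebra $\mathfrak F$ is strongly weakly Radon-Nikod\'ym (SWRN) but not uniformly weakly Radon-Nikod\'ym (UWRN).
   Context: For $A\subseteq\omega$ we write $A^1=A$ and $A^0=\omega\setminus A$. A family $\{a_i:i\in I\}$ in a Boolean algebra is independent if $\bigcap_{i\in I'}a_i\cap\bigcap_{i\in I''}a_i^c\neq 0$ for all finite disjoint $I',I''\subseteq I$. A Boolean algebra is SWRN if it is generated by a family containing no infinite independent sequence. A Boolean algebra $\mathfrak A$ is UWRN if it is generated by a family $\mathcal H=\bigcup_{n\ge 1}\mathcal H_n$ such that, for every $n\ge 1$, $\mathcal H_n$ contains no independent sequence of length $n$. *)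

theory Defs
  imports Main "HOL.Hull"
begin

text \<open>A Boolean algebra is represented by a subset \<open>B\<close> of a type of class
  \<^class>\<open>boolean_algebra\<close> that is closed under the operations; taking \<open>B = UNIV\<close> covers every
  Boolean algebra on a type, and subalgebras of \<open>P(\<omega>)\<close> live in the type \<^typ>\<open>nat set\<close>.\<close>

definition ba_subalgebra :: "'a::boolean_algebra set \<Rightarrow> bool" where
  "ba_subalgebra B \<longleftrightarrow> bot \<in> B \<and> top \<in> B \<and> (\<forall>x\<in>B. - x \<in> B) \<and>
     (\<forall>x\<in>B. \<forall>y\<in>B. inf x y \<in> B \<and> sup x y \<in> B)"

definition ba_generated :: "'a::boolean_algebra set \<Rightarrow> 'a set" where
  "ba_generated H = ba_subalgebra hull H"

text \<open>The meet of a finite set; inserting \<open>top\<close> makes the empty meet equal to \<open>top\<close>.\<close>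

definition finite_meet :: "'a::boolean_algebra set \<Rightarrow> 'a" where
  "finite_meet X = Inf_fin (insert top X)"

text \<open>Independence is a property of the indexed family; in particular, members with distinct
  indices are distinct.\<close>

definition ba_independent :: "'i set \<Rightarrow> ('i \<Rightarrow> 'a::boolean_algebra) \<Rightarrow> bool" where
  "ba_independent I a \<longleftrightarrow>
     (\<forall>I' I''. finite I' \<and> finite I'' \<and> I' \<subseteq> I \<and> I'' \<subseteq> I \<and> I' \<inter> I'' = {} \<longrightarrow>
        inf (finite_meet (a ` I')) (finite_meet ((\<lambda>i. - a i) ` I'')) \<noteq> bot)"

definition SWRN :: "'a::boolean_algebra set \<Rightarrow> bool" where
  "SWRN B \<longleftrightarrow> (\<exists>H. ba_generated H = B \<and>
     \<not> (\<exists>a :: nat \<Rightarrow> 'a. (\<forall>i. a i \<in> H) \<and> ba_independent UNIV a))"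

definition UWRN :: "'a::boolean_algebra set \<Rightarrow> bool" where
  "UWRN B \<longleftrightarrow> (\<exists>H :: nat \<Rightarrow> 'a set. ba_generated (\<Union>n\<in>{1..}. H n) = B \<and>
     (\<forall>n\<ge>1. \<not> (\<exists>a :: nat \<Rightarrow> 'a. (\<forall>i<n. a i \<in> H n) \<and> ba_independent {..<n} a)))"

text \<open>\<open>A\<^sup>1 = A\<close> and \<open>A\<^sup>0 = \<omega> - A\<close>; only the exponents \<open>0\<close> and \<open>1\<close> are used.\<close>

definition signed_set :: "nat set \<Rightarrow> nat \<Rightarrow> nat set" where
  "signed_set A e = (if e = 1 then A else UNIV - A)"

definition pairwise_finite_cell :: "nat set set \<Rightarrow> bool" where
  "pairwise_finite_cell G \<longleftrightarrow> (\<forall>A\<in>G. \<forall>B\<in>G. \<exists>e1\<in>{0,1}. \<exists>e2\<in>{0,1}.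
     finite (signed_set A e1 \<inter> signed_set B e2))"

definition maximal_pairwise_finite_cell :: "nat set set \<Rightarrow> bool" where
  "maximal_pairwise_finite_cell G \<longleftrightarrow> pairwise_finite_cell G \<and>
     (\<forall>G'. pairwise_finite_cell G' \<and> G \<subseteq> G' \<longrightarrow> G' = G)"

end

theory Submission
  imports Defs "HOL-Library.Ramsey" "HOL-Library.Diagonal_Subsequence"
begin

text \<open>
  The family \<open>\<G>\<close> itself witnesses SWRN: for two of its members \<open>A\<close> and \<open>B\<close> one of the four cells
  \<open>A\<^sup>\<epsilon> \<inter> B\<^sup>\<delta>\<close> is finite, whereas in an infinite independent sequence every such cell is
  cut into arbitrarily many nonempty pieces by the later members.

  For the failure of UWRN, say that a sequence \<open>s\<close> of points \<^emph>\<open>settles\<close> on a set \<open>A\<close> if it is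
  eventually inside \<open>A\<close> or eventually outside \<open>A\<close>; when this holds for all \<open>A\<close> in an algebra,
  \<open>s\<close> converges in its Stone space. The proof opposes two facts.

  \<^item> By maximality, no injective sequence \<open>s\<close> in \<open>\<omega>\<close> settles on all members of \<open>\<G>\<close>
    (\<open>maximal_pairwise_finite_cell_not_settled\<close>). Otherwise the set of the even-indexed terms of
    \<open>s\<close> has a finite cell with every member of \<open>\<G>\<close>, so it belongs to \<open>\<G>\<close>, but \<open>s\<close> does
    not settle on it.

  \<^item> If a family has no independent sequence of some fixed finite length \<open>n\<close>, then every sequence
    of points has a subsequence that settles on all members of the family
    (\<open>no_independent_imp_settled_subsequence\<close>). This is Rosenthal's dichotomy for a family of
    finite VC dimension, and in this case Ramsey's theorem for \<open>2\<^sup>n\<close>-element sets proves it.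

  If \<open>\<Union>n. \<H> n\<close> generates the algebra as in the definition of UWRN, a diagonal argument applied to
  the second fact gives an injective sequence that settles on every member of every \<open>\<H> n\<close>, hence
  on the whole algebra and on \<open>\<G>\<close>. This contradicts the first fact.
\<close>

section \<open>Independent families of sets\<close>

lemma mem_finite_meet_iff:
  assumes "finite X"
  shows "x \<in> finite_meet X \<longleftrightarrow> (\<forall>A\<in>X. x \<in> A)"
proof -
  have "finite_meet X = \<Inter> (insert UNIV X)"
    unfolding finite_meet_def using assms by (subst Inf_fin_Inf) auto
  then show ?thesis by auto
qed

lemma ba_independent_set_iff:
  fixes a :: "'i \<Rightarrow> 'a set"
  shows "ba_independent I a \<longleftrightarrow>
    (\<forall>I' I''. finite I' \<and> finite I'' \<and> I' \<subseteq> I \<and> I'' \<subseteq> I \<and> I' \<inter> I'' = {} \<longrightarrow>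
       (\<exists>x. (\<forall>i\<in>I'. x \<in> a i) \<and> (\<forall>i\<in>I''. x \<notin> a i)))"
proof -
  have "inf (finite_meet (a ` I')) (finite_meet ((\<lambda>i. - a i) ` I'')) \<noteq> bot \<longleftrightarrow>
      (\<exists>x. (\<forall>i\<in>I'. x \<in> a i) \<and> (\<forall>i\<in>I''. x \<notin> a i))"
    if "finite I'" "finite I''" for I' I''
    using that by (auto simp: mem_finite_meet_iff set_eq_iff)
  then show ?thesis
    unfolding ba_independent_def by (simp cong: conj_cong imp_cong)
qed

lemma ba_independent_realizes:
  fixes a :: "'i \<Rightarrow> 'a set"
  assumes "ba_independent I a" "finite J" "J \<subseteq> I"
  obtains x where "\<And>i. i \<in> J \<Longrightarrow> x \<in> a i \<longleftrightarrow> P i"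
proof -
  have "\<exists>x. (\<forall>i\<in>{i\<in>J. P i}. x \<in> a i) \<and> (\<forall>i\<in>{i\<in>J. \<not> P i}. x \<notin> a i)"
    using assms(1)[unfolded ba_independent_set_iff, rule_format, of "{i\<in>J. P i}" "{i\<in>J. \<not> P i}"]
      assms(2,3) by auto
  then show ?thesis using that by blast
qed

text \<open>
  For any \<open>N\<close>, independence gives points \<open>x k\<close>, \<open>k < N\<close>, in the given cell of \<open>a 0\<close> and \<open>a 1\<close>
  such that \<open>x k\<close> belongs to \<open>a (k + 2)\<close> and to no other of \<open>a 2, \<dots>, a (N + 1)\<close>. These points are
  distinct, so the cell has at least \<open>N\<close> elements.
\<close>

lemma infinite_cell_of_independent:
  fixes a :: "nat \<Rightarrow> 'a set"
  assumes "ba_independent UNIV a"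
  shows "infinite {x. (x \<in> a 0 \<longleftrightarrow> p) \<and> (x \<in> a 1 \<longleftrightarrow> q)}" (is "infinite ?C")
proof
  assume fin: "finite ?C"
  define N where "N = Suc (card ?C)"
  have "\<exists>x. x \<in> ?C \<and> (\<forall>i<N. x \<in> a (i + 2) \<longleftrightarrow> i = k)" for k
  proof -
    obtain x where x: "\<And>i. i \<in> {..<N + 2} \<Longrightarrow>
        x \<in> a i \<longleftrightarrow> (if i = 0 then p else if i = 1 then q else i = k + 2)"
      using ba_independent_realizes[OF assms, of "{..<N + 2}"
          "\<lambda>i. if i = 0 then p else if i = 1 then q else i = k + 2"] by blast
    have "x \<in> ?C" using x[of 0] x[of 1] by simp
    moreover have "\<forall>i<N. x \<in> a (i + 2) \<longleftrightarrow> i = k"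
      using x by (auto split: if_splits)
    ultimately show ?thesis by blast
  qed
  then obtain x where x: "\<And>k. x k \<in> ?C" "\<And>k i. i < N \<Longrightarrow> x k \<in> a (i + 2) \<longleftrightarrow> i = k"
    by metis
  have "inj_on x {..<N}"
    by (rule inj_onI) (metis lessThan_iff x(2))
  then have "card {..<N} \<le> card ?C"
    by (rule card_inj_on_le) (use x(1) fin in auto)
  then show False by (simp add: N_def)
qed

text \<open>
  Passing to the dual: index \<open>2\<^sup>n\<close> points by the subsets of \<open>{..<n}\<close>. If the family cuts out all sets
  of these points, then the sets \<open>{t S | i \<in> S}\<close>, for \<open>i < n\<close>, are traces of \<open>n\<close> of its members,
  and \<open>t S\<close> is a point in the Boolean cell of these members prescribed by \<open>S\<close>.
\<close>

lemma independent_if_shattered: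
  fixes t :: "nat set \<Rightarrow> 'a"
  assumes "\<And>\<U>. \<exists>A\<in>H. \<forall>S\<subseteq>{..<n}. t S \<in> A \<longleftrightarrow> S \<in> \<U>"
  shows "\<exists>a. (\<forall>i<n. a i \<in> H) \<and> ba_independent {..<n} a"
proof -
  have "\<forall>i. \<exists>A. A \<in> H \<and> (\<forall>S\<subseteq>{..<n}. t S \<in> A \<longleftrightarrow> i \<in> S)"
    using assms[of "{S. i \<in> S}" for i] unfolding mem_Collect_eq by blast
  then obtain a where a: "\<And>i. a i \<in> H" "\<And>i S. S \<subseteq> {..<n} \<Longrightarrow> t S \<in> a i \<longleftrightarrow> i \<in> S"
    by metis
  have "ba_independent {..<n} a"
    unfolding ba_independent_set_iff
  proof (intro allI impI)
    fix I' I'' assume I: "finite I' \<and> finite I'' \<and> I' \<subseteq> {..<n} \<and> I'' \<subseteq> {..<n} \<and> I' \<inter> I'' = {}"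
    then show "\<exists>x. (\<forall>i\<in>I'. x \<in> a i) \<and> (\<forall>i\<in>I''. x \<notin> a i)"
      by (intro exI[of _ "t I'"]) (auto simp: a(2))
  qed
  with a(1) show ?thesis by blast
qed

section \<open>Sequences that settle on sets\<close>

definition settles :: "(nat \<Rightarrow> 'a) \<Rightarrow> 'a set \<Rightarrow> bool" where
  "settles s A \<longleftrightarrow> (\<forall>\<^sub>F k in sequentially. s k \<in> A) \<or> (\<forall>\<^sub>F k in sequentially. s k \<notin> A)"

lemma settles_compose:
  assumes "settles s A" "filterlim r sequentially sequentially"
  shows "settles (s \<circ> r) A"
  using assms unfolding settles_def
  by (auto dest: eventually_compose_filterlim)

lemma settles_shift:
  "settles (s \<circ> (+) k) A \<longleftrightarrow> settles s A"
  unfolding settles_def comp_def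
  using eventually_sequentially_seg[of "\<lambda>j. s j \<in> A" k]
    eventually_sequentially_seg[of "\<lambda>j. s j \<notin> A" k] by (simp add: add.commute)

lemma ba_subalgebra_settled: "ba_subalgebra {A. settles s A}"
proof -
  have inter: "settles s (A \<inter> B)" if "settles s A" "settles s B" for A B
    using that unfolding settles_def Int_iff eventually_conj_iff
    by (metis (mono_tags, lifting) eventually_mono)
  have compl: "settles s (- A)" if "settles s A" for A
    using that unfolding settles_def by auto
  have "settles s (A \<union> B)" if "settles s A" "settles s B" for A B
    using compl[OF inter[OF compl compl]] that by simp
  moreover have "settles s {}" "settles s UNIV"
    unfolding settles_def by simp_all
  ultimately show ?thesis
    unfolding ba_subalgebra_def using inter compl by simp
qed

lemma settles_ba_generated:
  assumes "\<And>A. A \<in> H \<Longrightarrow> settles s A" "A \<in> ba_generated H"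
  shows "settles s A"
proof -
  have "ba_generated H \<subseteq> {A. settles s A}"
    unfolding ba_generated_def by (rule hull_minimal) (use assms(1) ba_subalgebra_settled in auto)
  then show ?thesis using assms(2) by auto
qed

lemma infinite_Collect_if_not_settles:
  fixes Y :: "nat set"
  assumes "\<not> settles (s \<circ> enumerate Y) A" "infinite Y"
  shows "infinite {k\<in>Y. s k \<in> A \<longleftrightarrow> b}"
proof -
  have "infinite {k. s (enumerate Y k) \<in> A \<longleftrightarrow> b}"
    using assms(1) unfolding settles_def
    by (cases b) (auto simp: eventually_cofinite simp flip: cofinite_eq_sequentially)
  moreover have "inj (enumerate Y)"
    using strict_mono_enumerate[OF assms(2)] by (rule strict_mono_imp_inj_on)
  ultimately have "infinite (enumerate Y ` {k. s (enumerate Y k) \<in> A \<longleftrightarrow> b})"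
    by (meson finite_imageD inj_on_subset subset_UNIV)
  moreover have "enumerate Y ` {k. s (enumerate Y k) \<in> A \<longleftrightarrow> b} \<subseteq> {k\<in>Y. s k \<in> A \<longleftrightarrow> b}"
    using assms(2) by (auto simp: enumerate_in_set)
  ultimately show ?thesis by (rule infinite_super[rotated])
qed

section \<open>Settling subsequences from Ramsey's theorem\<close>

text \<open>The zero-one patterns, coded as subsets of \<open>{..<m}\<close>, that members of \<open>H\<close> produce on the
  terms of \<open>s\<close> whose indices form the \<open>m\<close>-element set \<open>T\<close>, listed in increasing order.\<close>

definition patterns :: "'a set set \<Rightarrow> (nat \<Rightarrow> 'a) \<Rightarrow> nat \<Rightarrow> nat set \<Rightarrow> nat set set" where
  "patterns H s m T = {\<sigma>. \<sigma> \<subseteq> {..<m} \<and> (\<exists>A\<in>H. \<forall>i<m. s (sorted_list_of_set T ! i) \<in> A \<longleftrightarrow> i \<in> \<sigma>)}"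

text \<open>
  A set on which the sequence does not settle has infinitely many terms inside and infinitely many
  outside, so by alternating suitably it produces any given pattern somewhere.
\<close>

lemma pattern_if_not_settles:
  assumes "A \<in> H" "\<not> settles (s \<circ> enumerate Y) A" "infinite Y" "\<sigma> \<subseteq> {..<m}"
  shows "\<exists>T\<subseteq>Y. finite T \<and> card T = m \<and> \<sigma> \<in> patterns H s m T"
proof -
  have unbounded: "\<exists>y. (y \<in> Y \<and> (s y \<in> A \<longleftrightarrow> b)) \<and> x < y" for b x
    using infinite_Collect_if_not_settles[OF assms(2,3), of b] unfolding infinite_nat_iff_unbounded
    by auto
  have "\<exists>u. \<forall>i. (u i \<in> Y \<and> (s (u i) \<in> A \<longleftrightarrow> i \<in> \<sigma>)) \<and> u i < u (Suc i)"
    by (rule dependent_nat_choice) (use unbounded in blast)+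
  then obtain u :: "nat \<Rightarrow> nat"
    where u: "\<And>i. u i \<in> Y" "\<And>i. s (u i) \<in> A \<longleftrightarrow> i \<in> \<sigma>" "strict_mono u"
    unfolding strict_mono_Suc_iff by blast
  define T where "T = u ` {..<m}"
  have "map u [0..<m] = sorted_list_of_set T"
  proof (rule sorted_distinct_set_unique)
    show "sorted (map u [0..<m])"
      using u(3) by (auto simp: sorted_iff_nth_mono strict_mono_less_eq)
    show "distinct (map u [0..<m])"
      using u(3) by (simp add: distinct_map strict_mono_imp_inj_on inj_on_subset)
  qed (auto simp: T_def)
  then have "\<sigma> \<in> patterns H s m T"
    unfolding patterns_def using assms(1,4) u(2) by (auto simp flip: \<open>map u [0..<m] = _\<close>)
  moreover have "card T = m"
    unfolding T_def using u(3) by (simp add: card_image strict_mono_imp_inj_on inj_on_subset)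
  ultimately show ?thesis
    using u(1) by (intro exI[of _ T]) (auto simp: T_def)
qed

lemma independent_if_all_patterns:
  fixes s :: "nat \<Rightarrow> 'a" and n :: nat
  assumes "patterns H s (2 ^ n) T = Pow {..<2 ^ n}"
  shows "\<exists>a. (\<forall>i<n. a i \<in> H) \<and> ba_independent {..<n} a"
proof -
  have "card (Pow {..<n}) = card {..<(2::nat) ^ n}"
    by (simp add: card_Pow)
  then obtain e where e: "bij_betw e (Pow {..<n}) {..<(2::nat) ^ n}"
    using finite_same_card_bij[of "Pow {..<n}" "{..<(2::nat) ^ n}"] by auto
  show ?thesis
  proof (rule independent_if_shattered)
    fix \<U> :: "nat set set"
    define \<sigma> where "\<sigma> = e ` (\<U> \<inter> Pow {..<n})"
    have "\<sigma> \<in> patterns H s (2 ^ n) T"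
      unfolding assms \<sigma>_def using e by (auto simp: bij_betw_def)
    then obtain A where A: "A \<in> H" "\<forall>i<2^n. s (sorted_list_of_set T ! i) \<in> A \<longleftrightarrow> i \<in> \<sigma>"
      unfolding patterns_def by auto
    have "s (sorted_list_of_set T ! e S) \<in> A \<longleftrightarrow> S \<in> \<U>" if "S \<subseteq> {..<n}" for S
    proof -
      have "e S < 2 ^ n" using e that by (auto simp: bij_betw_def)
      moreover have "e S \<in> \<sigma> \<longleftrightarrow> S \<in> \<U>"
        unfolding \<sigma>_def using e that by (auto simp: bij_betw_def dest: inj_onD)
      ultimately show ?thesis using A(2) by simp
    qed
    with A(1) show "\<exists>A\<in>H. \<forall>S\<subseteq>{..<n}. s (sorted_list_of_set T ! e S) \<in> A \<longleftrightarrow> S \<in> \<U>"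
      by blast
  qed
qed

text \<open>
  Colour each \<open>2\<^sup>n\<close>-element set of indices with the set of its patterns. On a homogeneous set of
  indices some pattern is missing throughout, because all patterns at once would give \<open>n\<close>
  independent members; but a member on which the subsequence does not settle would produce it.
\<close>

lemma no_independent_imp_settled_subsequence:
  fixes s :: "nat \<Rightarrow> 'a" and n :: nat
  assumes "\<not> (\<exists>a. (\<forall>i<n. a i \<in> H) \<and> ba_independent {..<n} a)"
  shows "\<exists>r. strict_mono r \<and> (\<forall>A\<in>H. settles (s \<circ> r) A)"
proof -
  define m :: nat where "m = 2 ^ n"
  obtain c :: "nat set set \<Rightarrow> nat" where c: "bij_betw c (Pow (Pow {..<m})) {0..<card (Pow (Pow {..<m}))}"
    using ex_bij_betw_finite_nat[of "Pow (Pow {..<m})"] by auto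
  have patterns_range: "patterns H s m T \<in> Pow (Pow {..<m})" for T
    unfolding patterns_def by auto
  have colour: "\<forall>T. T \<subseteq> UNIV \<and> finite T \<and> card T = m \<longrightarrow>
      c (patterns H s m T) < card (Pow (Pow {..<m}))"
    using bij_betwE[OF c] patterns_range by (meson atLeastLessThan_iff)
  obtain Y t where Y: "infinite Y"
      "\<And>T. T \<subseteq> Y \<Longrightarrow> finite T \<Longrightarrow> card T = m \<Longrightarrow> c (patterns H s m T) = t"
    using Ramsey[OF infinite_UNIV_nat colour] by metis
  obtain T0 where T0: "T0 \<subseteq> Y" "finite T0" "card T0 = m"
    using infinite_arbitrarily_large[OF Y(1)] by blast
  have "patterns H s m T0 \<noteq> Pow {..<m}"
    using assms independent_if_all_patterns[of H s n T0] unfolding m_def by blast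
  then obtain \<sigma> where \<sigma>: "\<sigma> \<subseteq> {..<m}" "\<sigma> \<notin> patterns H s m T0"
    using patterns_range[of T0] by auto
  have "\<sigma> \<notin> patterns H s m T" if "T \<subseteq> Y" "finite T" "card T = m" for T
  proof -
    have "patterns H s m T = patterns H s m T0"
      using bij_betw_imp_inj_on[OF c] patterns_range Y(2)[OF that] Y(2)[OF T0]
      by (metis inj_onD)
    with \<sigma>(2) show ?thesis by simp
  qed
  then have "\<forall>A\<in>H. settles (s \<circ> enumerate Y) A"
    using pattern_if_not_settles[OF _ _ Y(1) \<sigma>(1)] by blast
  then show ?thesis
    using strict_mono_enumerate[OF Y(1)] by blast
qed

lemma diagonal_settled_subsequence:
  fixes s :: "nat \<Rightarrow> 'a" and H :: "nat \<Rightarrow> 'a set set"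
  assumes "\<And>n (s :: nat \<Rightarrow> 'a). \<exists>r. strict_mono r \<and> (\<forall>A\<in>H n. settles (s \<circ> r) A)"
  shows "\<exists>r. strict_mono r \<and> (\<forall>n. \<forall>A\<in>H n. settles (s \<circ> r) A)"
proof -
  interpret subseqs "\<lambda>n r. \<forall>A\<in>H n. settles (s \<circ> r) A"
  proof
    fix n :: nat and q :: "nat \<Rightarrow> nat"
    show "\<exists>r. strict_mono r \<and> (\<forall>A\<in>H n. settles (s \<circ> (q \<circ> r)) A)"
      using assms[of n "s \<circ> q"] by (simp add: comp_assoc)
  qed
  have "\<forall>A\<in>H n. settles (s \<circ> (diagseq \<circ> (+) (Suc n))) A" for n
  proof (rule diagseq_holds)
    fix q r :: "nat \<Rightarrow> nat" and n :: nat
    assume "strict_mono r" "\<forall>A\<in>H n. settles (s \<circ> q) A"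
    then show "\<forall>A\<in>H n. settles (s \<circ> (q \<circ> r)) A"
      using settles_compose[of "s \<circ> q" _ r] filterlim_subseq by (auto simp: comp_assoc)
  qed
  then have "settles (s \<circ> diagseq) A" if "A \<in> H n" for A n
    using that settles_shift[of "s \<circ> diagseq" "Suc n" A] by (simp add: comp_assoc)
  then show ?thesis using subseq_diagseq by blast
qed

section \<open>Maximal families with finite cells\<close>

lemma finite_signed_cell_if_settles:
  fixes s :: "nat \<Rightarrow> nat"
  assumes "settles s A" "B \<subseteq> range s"
  shows "\<exists>e\<in>{0,1}. finite (signed_set A e \<inter> B)"
proof -
  have fin: "finite (X \<inter> B)" if "finite {k. s k \<in> X}" for X
    by (rule finite_subset[OF _ finite_imageI[OF that, of s]]) (use assms(2) in auto)
  have "finite {k. s k \<in> UNIV - A} \<or> finite {k. s k \<in> A}"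
    using assms(1) unfolding settles_def
    by (auto simp: eventually_cofinite simp flip: cofinite_eq_sequentially)
  then show ?thesis
    using fin[of A] fin[of "UNIV - A"] unfolding signed_set_def by auto
qed

lemma maximal_pairwise_finite_cell_not_settled:
  assumes max: "maximal_pairwise_finite_cell G" and "inj s"
  shows "\<exists>A\<in>G. \<not> settles s A"
proof (rule ccontr)
  assume "\<not> ?thesis"
  then have all: "settles s A" if "A \<in> G" for A using that by blast
  define B where "B = s ` {k. even k}"
  have mixed: "\<exists>e\<in>{0,1}. finite (signed_set A e \<inter> B)" if "A \<in> G" for A
    using finite_signed_cell_if_settles[OF all[OF that], of B] by (auto simp: B_def)
  have pair: "pairwise_finite_cell G"
    using max by (simp add: maximal_pairwise_finite_cell_def)
  have left: "\<exists>e1\<in>{0,1}. \<exists>e2\<in>{0,1}. finite (signed_set A e1 \<inter> signed_set B e2)" if "A \<in> G" for A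
    using mixed[OF that] by (auto simp: signed_set_def[of B])
  have right: "\<exists>e1\<in>{0,1}. \<exists>e2\<in>{0,1}. finite (signed_set B e1 \<inter> signed_set A e2)" if "A \<in> G" for A
    using left[OF that] by (metis inf_commute)
  have self: "\<exists>e1\<in>{0,1}. \<exists>e2\<in>{0,1}. finite (signed_set B e1 \<inter> signed_set B e2)"
    unfolding signed_set_def by (intro bexI[of _ 0] bexI[of _ 1]) auto
  have "pairwise_finite_cell (insert B G)"
    unfolding pairwise_finite_cell_def
    using pair[unfolded pairwise_finite_cell_def] left right self by simp
  then have "B \<in> G"
    using max unfolding maximal_pairwise_finite_cell_def by blast
  then have "settles s B" by (rule all)
  moreover have "s k \<in> B \<longleftrightarrow> even k" for k
    using \<open>inj s\<close> by (auto simp: B_def inj_image_mem_iff)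
  ultimately have "(\<forall>\<^sub>F k in sequentially. even k) \<or> (\<forall>\<^sub>F k in sequentially. odd (k::nat))"
    unfolding settles_def by simp
  then obtain N :: nat where "(\<forall>k\<ge>N. even k) \<or> (\<forall>k\<ge>N. odd k)"
    unfolding eventually_sequentially by blast
  then show False
    using even_Suc[of N] le_SucI[OF order_refl, of N] by blast
qed

lemma pairwise_finite_cell_no_independent_sequence:
  assumes "pairwise_finite_cell G" "\<And>i. a i \<in> G"
  shows "\<not> ba_independent UNIV (a :: nat \<Rightarrow> nat set)"
proof
  assume ind: "ba_independent UNIV a"
  obtain e1 e2 where "finite (signed_set (a 0) e1 \<inter> signed_set (a 1) e2)"
    using assms unfolding pairwise_finite_cell_def by blast
  also have "signed_set (a 0) e1 \<inter> signed_set (a 1) e2 =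
      {x. (x \<in> a 0 \<longleftrightarrow> e1 = 1) \<and> (x \<in> a 1 \<longleftrightarrow> e2 = 1)}"
    unfolding signed_set_def by auto
  finally show False
    using infinite_cell_of_independent[OF ind] by blast
qed

theorem corollary9p5:
  fixes G F :: "nat set set"
  assumes "maximal_pairwise_finite_cell G"
    and "F = ba_generated G"
  shows "SWRN F \<and> \<not> UWRN F"
proof
  have "pairwise_finite_cell G"
    using assms(1) by (simp add: maximal_pairwise_finite_cell_def)
  then show "SWRN F"
    unfolding SWRN_def using assms(2) pairwise_finite_cell_no_independent_sequence by blast
next
  show "\<not> UWRN F"
  proof
    assume "UWRN F"
    then obtain H :: "nat \<Rightarrow> nat set set" where gen: "ba_generated (\<Union>n\<in>{1..}. H n) = F"
      and no_ind: "\<And>n. n \<ge> 1 \<Longrightarrow> \<not> (\<exists>a. (\<forall>i<n. a i \<in> H n) \<and> ba_independent {..<n} a)"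
      unfolding UWRN_def by blast
    have "\<exists>r. strict_mono r \<and> (\<forall>A\<in>H (Suc n). settles (s \<circ> r) A)" for n and s :: "nat \<Rightarrow> nat"
      by (rule no_independent_imp_settled_subsequence[OF no_ind]) simp
    from diagonal_settled_subsequence[of "\<lambda>n. H (Suc n)", OF this, of id]
    obtain r where r: "strict_mono r" "\<And>n A. A \<in> H (Suc n) \<Longrightarrow> settles r A"
      by auto
    have "settles r A" if "A \<in> (\<Union>n\<in>{1..}. H n)" for A
    proof -
      from that obtain n where "n \<ge> 1" "A \<in> H n" by auto
      then show ?thesis using r(2)[of A "n - 1"] by simp
    qed
    then have settled: "settles r A" if "A \<in> F" for A
      using settles_ba_generated that gen by blast
    have "G \<subseteq> F"
      unfolding assms(2) ba_generated_def by (rule hull_subset)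
    moreover have "inj r"
      using r(1) by (rule strict_mono_imp_inj_on)
    ultimately show False
      using maximal_pairwise_finite_cell_not_settled[OF assms(1)] settled by blast
  qed
qed

end
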